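(* Let $C:[0,1]^2\to[0,1]$ be a commutative fuzzy conjunction, let $N_C:[0,1]\to[0,1]$, $N_C(x)=\sup\{t\in[0,1]\mid C(x,t)=0\}$, be its natural negation, and suppose that $N_C$ is a fuzzy negation. Then the following statements are equivalent: (i) $N_C$ is strictly decreasing. (ii) $N_C$ is continuous. (iii) $N_C$ is strict. (iv) $N_C$ is strong.
   Context: A fuzzy conjunction is a function $C:[0,1]^2\to[0,1]$ that is non-decreasing in each variable and satisfies $C(1,1)=1$ and $C(0,0)=C(1,0)=C(0,1)=0$. It is commutative if $C(x,y)=C(y,x)$ for all $x,y\in[0,1]$. A fuzzy negation is a non-increasing function $N:[0,1]\to[0,1]$ with $N(0)=1$ and $N(1)=0$. A fuzzy negation $N$ is strict if it is strictly decreasing and continuous; it is strong if $N(N(x))=x$ for all $x\in[0,1]$. *)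

theory Defs
  imports "HOL-Analysis.Analysis"
begin

text \<open>
  Functions on the unit interval (square) are total functions on the reals of which only the
  values at arguments in \<open>{0..1}\<close> matter: every condition below is relativised to \<open>{0..1}\<close>.
\<close>

definition fuzzy_conjunction :: "(real \<Rightarrow> real \<Rightarrow> real) \<Rightarrow> bool" where
  "fuzzy_conjunction C \<longleftrightarrow>
     (\<forall>x\<in>{0..1}. \<forall>y\<in>{0..1}. C x y \<in> {0..1}) \<and>
     (\<forall>y\<in>{0..1}. mono_on {0..1} (\<lambda>x. C x y)) \<and>
     (\<forall>x\<in>{0..1}. mono_on {0..1} (\<lambda>y. C x y)) \<and>
     C 1 1 = 1 \<and> C 0 0 = 0 \<and> C 1 0 = 0 \<and> C 0 1 = 0"

definition commutative_conjunction :: "(real \<Rightarrow> real \<Rightarrow> real) \<Rightarrow> bool" where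
  "commutative_conjunction C \<longleftrightarrow> (\<forall>x\<in>{0..1}. \<forall>y\<in>{0..1}. C x y = C y x)"

definition fuzzy_negation :: "(real \<Rightarrow> real) \<Rightarrow> bool" where
  "fuzzy_negation N \<longleftrightarrow>
     (\<forall>x\<in>{0..1}. N x \<in> {0..1}) \<and> antimono_on {0..1} N \<and> N 0 = 1 \<and> N 1 = 0"

definition strict_negation :: "(real \<Rightarrow> real) \<Rightarrow> bool" where
  "strict_negation N \<longleftrightarrow>
     fuzzy_negation N \<and> strict_antimono_on {0..1} N \<and> continuous_on {0..1} N"

definition strong_negation :: "(real \<Rightarrow> real) \<Rightarrow> bool" where
  "strong_negation N \<longleftrightarrow> fuzzy_negation N \<and> (\<forall>x\<in>{0..1}. N (N x) = x)"

text \<open>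
  For a fuzzy conjunction \<open>C\<close> and \<open>x \<in> {0..1}\<close> the set below contains \<open>0\<close> and is bounded, so
  the real \<open>Sup\<close> is the supremum in the unit interval.
\<close>

definition natural_negation :: "(real \<Rightarrow> real \<Rightarrow> real) \<Rightarrow> real \<Rightarrow> real" where
  "natural_negation C x = Sup {t \<in> {0..1}. C x t = 0}"

end

theory Submission
  imports Defs
begin

text \<open>
  Write \<open>N\<close> for the natural negation of \<open>C\<close>. Commutativity of \<open>C\<close> makes \<open>N\<close> almost a Galois
  connection with itself: \<open>y < N x\<close> forces \<open>C x y = 0\<close>, hence \<open>C y x = 0\<close>, hence \<open>x \<le> N y\<close>. This
  exchange property (lemma \<open>natural_negation_exchange\<close>) is all that is used about \<open>C\<close>; the rest
  holds for every fuzzy negation \<open>N\<close> with it.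

  If \<open>N\<close> is strictly decreasing, a point strictly between \<open>x\<close> and \<open>N (N x)\<close> violates the
  exchange property, so \<open>N\<close> is an involution. A strong negation is an order-reversing bijection
  of the unit interval, hence strictly decreasing and continuous. Finally, if \<open>N\<close> is continuous,
  it is onto the unit interval; were it constant with value \<open>c\<close> on some \<open>{x..y}\<close>, then \<open>N w \<ge> y\<close>
  for \<open>w < c\<close> and \<open>N w \<le> x\<close> for \<open>w > c\<close>, so that \<open>N\<close> would miss all points of \<open>{x<..<y}\<close>
  except possibly \<open>N c\<close>.
\<close>

lemma natural_negation_exchange:
  assumes C: "fuzzy_conjunction C" "commutative_conjunction C"
    and x: "x \<in> {0..1}" and y: "y \<in> {0..1}"
    and less: "y < natural_negation C x"
  shows "x \<le> natural_negation C y"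
proof -
  have ran: "C u v \<in> {0..1}" if "u \<in> {0..1}" "v \<in> {0..1}" for u v
    using C(1) that by (auto simp: fuzzy_conjunction_def)
  have mono: "C u v \<le> C u w" if "u \<in> {0..1}" "v \<in> {0..1}" "w \<in> {0..1}" "v \<le> w" for u v w
    using C(1) that by (auto simp: fuzzy_conjunction_def mono_on_def)
  have "C 1 0 = 0"
    using C(1) by (simp add: fuzzy_conjunction_def)
  moreover have "mono_on {0..1} (\<lambda>u. C u 0)"
    using C(1) by (simp add: fuzzy_conjunction_def)
  then have "C x 0 \<le> C 1 0"
    using mono_onD[of "{0..1}" "\<lambda>u. C u 0" x 1] x by simp
  ultimately have "C x 0 = 0"
    using ran[OF x, of 0] by simp
  then have "{t \<in> {0..1}. C x t = 0} \<noteq> {}"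
    by (auto intro!: exI[of _ 0])
  then obtain s where s: "s \<in> {0..1}" "C x s = 0" "y < s"
    using less_cSupD[OF _ less[unfolded natural_negation_def]] by blast
  have "C x y = 0"
    using mono[OF x y s(1)] s ran[OF x y] by simp
  then have "C y x = 0"
    using C(2) x y by (simp add: commutative_conjunction_def)
  moreover have "bdd_above {t \<in> {0..1}. C y t = 0}"
    by (auto intro!: bdd_aboveI[of _ 1])
  ultimately show ?thesis
    unfolding natural_negation_def using x by (intro cSup_upper) auto
qed

lemma strong_negation_if_strict_antimono:
  fixes N :: "real \<Rightarrow> real"
  assumes N: "fuzzy_negation N"
    and exch: "\<And>x y. x \<in> {0..1} \<Longrightarrow> y \<in> {0..1} \<Longrightarrow> y < N x \<Longrightarrow> x \<le> N y"
    and strict: "strict_antimono_on {0..1} N"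
  shows "strong_negation N"
proof -
  have ran: "N x \<in> {0..1}" if "x \<in> {0..1}" for x
    using N that by (simp add: fuzzy_negation_def)
  have less: "N y < N x" if "x \<in> {0..1}" "y \<in> {0..1}" "x < y" for x y
    using strict that by (auto simp: monotone_on_def)
  have "N (N x) = x" if x: "x \<in> {0..1}" for x
  proof (rule ccontr)
    assume "N (N x) \<noteq> x"
    then consider "x < N (N x)" | "N (N x) < x" by linarith
    then show False
    proof cases
      case 1
      then obtain z where z: "x < z" "z < N (N x)" using dense by blast
      then have z01: "z \<in> {0..1}" using x ran[OF ran[OF x]] by auto
      show False using exch[OF ran[OF x] z01 z(2)] less[OF x z01 z(1)] by simp
    next
      case 2
      then obtain z where z: "N (N x) < z" "z < x" using dense by blast
      then have z01: "z \<in> {0..1}" using x ran[OF ran[OF x]] by auto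
      show False using exch[OF z01 ran[OF x] less[OF z01 x z(2)]] z(1) by simp
    qed
  qed
  then show ?thesis using N by (simp add: strong_negation_def)
qed

lemma strong_negation_strict_antimono:
  assumes "strong_negation N"
  shows "strict_antimono_on {0..1} N"
proof (rule monotone_onI)
  fix x y :: real
  assume xy: "x \<in> {0..1}" "y \<in> {0..1}" "x < y"
  have "N y \<le> N x"
    using assms xy by (auto simp: strong_negation_def fuzzy_negation_def monotone_on_def)
  moreover have "N (N x) = x" "N (N y) = y"
    using assms xy by (auto simp: strong_negation_def)
  then have "N x \<noteq> N y" using xy(3) by force
  ultimately show "N x > N y" by simp
qed

lemma strong_negation_continuous_on:
  assumes N: "strong_negation N"
  shows "continuous_on {0..1} N"
proof -
  have ran: "N x \<in> {0..1}" if "x \<in> {0..1}" for x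
    using N that by (simp add: strong_negation_def fuzzy_negation_def)
  have inv: "N (N x) = x" if "x \<in> {0..1}" for x
    using N that by (simp add: strong_negation_def)
  have less: "N y < N x" if "x \<in> {0..1}" "y \<in> {0..1}" "x < y" for x y
    using strong_negation_strict_antimono[OF N] that by (auto simp: monotone_on_def)
  have "(N \<longlongrightarrow> N x) (at x within {0..1})" if x: "x \<in> {0..1}" for x
  proof (rule order_tendstoI)
    fix a assume a: "a < N x"
    show "\<forall>\<^sub>F y in at x within {0..1}. a < N y"
    proof (cases "a < 0")
      case True
      then show ?thesis
        using ran by (intro eventually_at_filter[THEN iffD2] always_eventually) force
    next
      case False
      then have a01: "a \<in> {0..1}" using a ran[OF x] by auto
      have "x < N a" using less[OF a01 ran[OF x] a] inv[OF x] by simp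
      then have "\<forall>\<^sub>F y in nhds x. y < N a" by (intro order_tendstoD[OF filterlim_ident])
      then show ?thesis unfolding eventually_at_filter
        by eventually_elim (use less[OF _ ran[OF a01]] inv[OF a01] in auto)
    qed
  next
    fix a assume a: "N x < a"
    show "\<forall>\<^sub>F y in at x within {0..1}. N y < a"
    proof (cases "a > 1")
      case True
      then show ?thesis
        using ran by (intro eventually_at_filter[THEN iffD2] always_eventually) force
    next
      case False
      then have a01: "a \<in> {0..1}" using a ran[OF x] by auto
      have "N a < x" using less[OF ran[OF x] a01 a] inv[OF x] by simp
      then have "\<forall>\<^sub>F y in nhds x. N a < y" by (intro order_tendstoD[OF filterlim_ident])
      then show ?thesis unfolding eventually_at_filter
        by eventually_elim (use less[OF ran[OF a01]] inv[OF a01] in auto)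
    qed
  qed
  then show ?thesis by (simp add: continuous_on_def)
qed

lemma strict_antimono_if_continuous_on:
  fixes N :: "real \<Rightarrow> real"
  assumes N: "fuzzy_negation N"
    and exch: "\<And>x y. x \<in> {0..1} \<Longrightarrow> y \<in> {0..1} \<Longrightarrow> y < N x \<Longrightarrow> x \<le> N y"
    and cont: "continuous_on {0..1} N"
  shows "strict_antimono_on {0..1} N"
proof (rule monotone_onI, rule ccontr)
  fix x y :: real
  assume xy: "x \<in> {0..1}" "y \<in> {0..1}" "x < y" and "\<not> N x > N y"
  moreover have "N y \<le> N x"
    using N xy by (auto simp: fuzzy_negation_def monotone_on_def)
  ultimately have eq: "N y = N x" by simp
  \<comment> \<open>The infinite interval \<open>{x<..<y}\<close> contains a point other than \<open>N (N x)\<close>, the only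
    point of it that can be a value of \<open>N\<close>.\<close>
  have "infinite ({x<..<y} - {N (N x)})"
    using xy(3) by (simp add: infinite_Ioo)
  then obtain v where v: "x < v" "v < y" "v \<noteq> N (N x)"
    by (metis DiffE finite.emptyI ex_in_conv greaterThanLessThan_iff insertI1)
  have "\<exists>w\<ge>0. w \<le> 1 \<and> N w = v"
    using N v xy cont by (intro IVT2') (auto simp: fuzzy_negation_def)
  then obtain w where w: "w \<in> {0..1}" "N w = v" by auto
  consider "w < N y" | "w = N x" | "w > N x" using eq by linarith
  then show False
  proof cases
    case 1
    then show False using exch[OF xy(2) w(1)] w(2) v by simp
  next
    case 2
    then show False using w(2) v by simp
  next
    case 3
    then show False using exch[OF w(1) xy(1)] w(2) v by simp
  qed
qed

theorem theorem3p1: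
  fixes C :: "real \<Rightarrow> real \<Rightarrow> real"
  assumes "fuzzy_conjunction C"
    and "commutative_conjunction C"
    and "fuzzy_negation (natural_negation C)"
  shows "(strict_antimono_on {0..1} (natural_negation C) \<longleftrightarrow>
            continuous_on {0..1} (natural_negation C)) \<and>
         (continuous_on {0..1} (natural_negation C) \<longleftrightarrow>
            strict_negation (natural_negation C)) \<and>
         (strict_negation (natural_negation C) \<longleftrightarrow>
            strong_negation (natural_negation C))"
proof -
  let ?N = "natural_negation C"
  note exch = natural_negation_exchange[OF assms(1,2)]
  have "strict_antimono_on {0..1} ?N \<Longrightarrow> strong_negation ?N"
    using strong_negation_if_strict_antimono[OF assms(3) exch] by blast
  moreover have "continuous_on {0..1} ?N \<Longrightarrow> strict_antimono_on {0..1} ?N"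
    using strict_antimono_if_continuous_on[OF assms(3) exch] by blast
  moreover have "strong_negation ?N \<Longrightarrow> strict_negation ?N"
    using strong_negation_strict_antimono strong_negation_continuous_on assms(3)
    by (auto simp: strict_negation_def)
  moreover have "strict_negation ?N \<Longrightarrow> strict_antimono_on {0..1} ?N \<and> continuous_on {0..1} ?N"
    by (simp add: strict_negation_def)
  ultimately show ?thesis by blast
qed

end
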